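(* Consider the opinion dynamics on $\mathbb{R}^{N_a}$ $$\dot x_i = -d\,x_i + u\,S\Big(\alpha x_i + \gamma \sum_{k=1,\,k\neq i}^{N_a} \bar a_{ik} x_k\Big),\qquad i=1,\dots,N_a,$$ with $d>0$, $\alpha\ge 0$, $u\ge 0$, and $\bar A=(\bar a_{ik})$ the $0/1$ adjacency matrix of an undirected, connected graph $\bar G$ with vertex set $V=\{1,\dots,N_a\}$. Let $\Gamma$ be the automorphism group of $\bar G$, and for $i,k\in V$ write $i\sim k$ if $k=\rho i$ for some $\rho\in\Gamma$. Let $\lambda_{max},\lambda_{min}$ be the largest and smallest eigenvalues of $\bar A$. **A.** Suppose $\gamma>0$. For the agreement equilibria $\mathbf{x}=(x_1,\dots,x_{N_a})$ that emerge from $\mathbf{x}=\mathbf{0}$ in the steady-state bifurcation at $u=u_a:=\frac{d}{\alpha+\gamma\lambda_{max}}$ along the $\lambda_{max}$-eigenspace of $\bar A$: if $i\sim k$, then $x_i=x_k$. **B.** Suppose $\gamma<0$ and $\lambda_{min}$ has multiplicity $1$. For the disagreement equilibria $\mathbf{x}=(x_1,\dots,x_{N_a})$ that emerge from $\mathbf{x}=\mathbf{0}$ in the steady-state bifurcation at $u=u_d:=\frac{d}{\alpha+\gamma\lambda_{min}}$ along the $\lambda_{min}$-eigenspace of $\bar A$: if $i\sim k$, then $|x_i|=|x_k|$.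
   Context: Standing assumptions: $N_a\ge 2$; the graph has no self-loops; $\bar a_{ik}\in\{0,1\}$ with $\bar a_{ik}=1$ iff $(i,k)$ is an edge, so $\bar A$ is symmetric. $S:\mathbb{R}\to\mathbb{R}$ is an odd, saturating (bounded), twice continuously differentiable function with $S(0)=0$, $S'(0)=1$, and $\operatorname{sign}(S''(z))=-\operatorname{sign}(z)$ for all $z$. A graph automorphism is a permutation of the vertices mapping edges to edges and non-edges to non-edges. For $\gamma>0$, at $u=u_a$ branches of nonzero equilibria emerge from $\mathbf{x}=\mathbf{0}$ along (tangent to) the $\lambda_{max}$-eigenspace of $\bar A$; they are agreement equilibria ($x_i\ne0$ and $\operatorname{sign}(x_i)=\operatorname{sign}(x_k)$ for all $i,k\in V$). For $\gamma<0$, at $u=u_d$ branches of nonzero equilibria emerge from $\mathbf{x}=\mathbf{0}$ along (tangent to) the $\lambda_{min}$-eigenspace of $\bar A$; they are disagreement equilibria ($\operatorname{sign}(x_i)=-\operatorname{sign}(x_k)\ne0$ for at least one pair $i,k$). The statement concerns equilibria on these branches with $(\mathbf{x},u)$ sufficiently close to the bifurcation point $(\mathbf{0},u_a)$, respectively $(\mathbf{0},u_d)$. *)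

theory Defs
  imports "HOL-Analysis.Analysis"
begin

definition simple_graph :: "('n \<Rightarrow> 'n \<Rightarrow> bool) \<Rightarrow> bool" where
  "simple_graph E \<longleftrightarrow> (\<forall>i k. E i k \<longrightarrow> E k i) \<and> (\<forall>i. \<not> E i i)"

definition connected_graph :: "('n \<Rightarrow> 'n \<Rightarrow> bool) \<Rightarrow> bool" where
  "connected_graph E \<longleftrightarrow> (\<forall>i k. E\<^sup>*\<^sup>* i k)"

definition adjacency :: "('n::finite \<Rightarrow> 'n \<Rightarrow> bool) \<Rightarrow> real^'n^'n" where
  "adjacency E = (\<chi> i k. if E i k then 1 else 0)"

definition automorphisms :: "('n \<Rightarrow> 'n \<Rightarrow> bool) \<Rightarrow> ('n \<Rightarrow> 'n) set" where
  "automorphisms E = {\<rho>. bij \<rho> \<and> (\<forall>i k. E (\<rho> i) (\<rho> k) \<longleftrightarrow> E i k)}"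

definition same_orbit :: "('n \<Rightarrow> 'n \<Rightarrow> bool) \<Rightarrow> 'n \<Rightarrow> 'n \<Rightarrow> bool" where
  "same_orbit E i k \<longleftrightarrow> (\<exists>\<rho>\<in>automorphisms E. k = \<rho> i)"

definition eigenspace :: "real^'n^'n \<Rightarrow> real \<Rightarrow> (real^'n) set" where
  "eigenspace A l = {v. A *v v = l *\<^sub>R v}"

definition eigenvalues :: "real^'n^'n \<Rightarrow> real set" where
  "eigenvalues A = {l. \<exists>v. v \<noteq> 0 \<and> v \<in> eigenspace A l}"

definition lambda_max :: "real^'n^'n \<Rightarrow> real" where
  "lambda_max A = Max (eigenvalues A)"

definition lambda_min :: "real^'n^'n \<Rightarrow> real" where
  "lambda_min A = Min (eigenvalues A)"

text \<open>Only used for symmetric matrices, where geometric and algebraic multiplicity coincide.\<close>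

definition eigen_multiplicity :: "real^'n^'n \<Rightarrow> real \<Rightarrow> nat" where
  "eigen_multiplicity A l = dim (eigenspace A l)"

definition saturating :: "(real \<Rightarrow> real) \<Rightarrow> bool" where
  "saturating S \<longleftrightarrow>
     (\<forall>z. S (- z) = - S z) \<and> bounded (range S) \<and>
     (\<forall>z. S field_differentiable at z) \<and>
     (\<forall>z. deriv S field_differentiable at z) \<and>
     continuous_on UNIV (deriv (deriv S)) \<and>
     S 0 = 0 \<and> deriv S 0 = 1 \<and>
     (\<forall>z. sgn (deriv (deriv S) z) = - sgn z)"

definition opinion_field ::
  "real \<Rightarrow> real \<Rightarrow> real \<Rightarrow> (real \<Rightarrow> real) \<Rightarrow> real^'n^'n \<Rightarrow> real \<Rightarrow> real^'n \<Rightarrow> real^'n" where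
  "opinion_field d \<alpha> \<gamma> S A u x =
     (\<chi> i. - d * x $ i + u * S (\<alpha> * x $ i + \<gamma> * (\<Sum>k\<in>UNIV - {i}. A $ i $ k * x $ k)))"

definition equilibrium ::
  "real \<Rightarrow> real \<Rightarrow> real \<Rightarrow> (real \<Rightarrow> real) \<Rightarrow> real^'n^'n \<Rightarrow> real \<Rightarrow> real^'n \<Rightarrow> bool" where
  "equilibrium d \<alpha> \<gamma> S A u x \<longleftrightarrow> opinion_field d \<alpha> \<gamma> S A u x = 0"

definition agreement :: "real^'n \<Rightarrow> bool" where
  "agreement x \<longleftrightarrow> (\<forall>i k. x $ i \<noteq> 0 \<and> sgn (x $ i) = sgn (x $ k))"

definition disagreement :: "real^'n \<Rightarrow> bool" where
  "disagreement x \<longleftrightarrow> (\<exists>i k. sgn (x $ i) = - sgn (x $ k) \<and> sgn (x $ k) \<noteq> 0)"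

text \<open>
  A branch is a continuous curve of pairs (opinion vector, attention u) starting at the
  bifurcation point and consisting of nonzero equilibria afterwards. Tangency to the subspace W is
  stated independently of the parametrization: the directions of the opinion vectors converge
  to a (necessarily unit) vector of W.
\<close>

definition emerging_branch ::
  "real \<Rightarrow> real \<Rightarrow> real \<Rightarrow> (real \<Rightarrow> real) \<Rightarrow> real^'n^'n \<Rightarrow> real \<Rightarrow> (real^'n) set
     \<Rightarrow> (real \<Rightarrow> (real^'n) \<times> real) \<Rightarrow> bool" where
  "emerging_branch d \<alpha> \<gamma> S A u0 W p \<longleftrightarrow>
     path p \<and> pathstart p = (0, u0) \<and>
     (\<forall>s\<in>{0<..1}. fst (p s) \<noteq> 0 \<and> snd (p s) \<ge> 0 \<and>
        equilibrium d \<alpha> \<gamma> S A (snd (p s)) (fst (p s))) \<and>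
     (\<exists>v\<in>W. ((\<lambda>s. fst (p s) /\<^sub>R norm (fst (p s))) \<longlongrightarrow> v) (at_right 0))"

end

theory Submission
  imports Defs
begin

text \<open>
  If \<open>x\<close> is an equilibrium and \<open>\<rho>\<close> an automorphism, then \<open>x \<circ> \<rho>\<close> is an equilibrium for the same
  \<open>u\<close>, so both parts reduce to a uniqueness statement.

  For \<open>\<gamma> > 0\<close>, the map \<open>S\<close> is increasing and \<open>S (t z) > t S z\<close> for \<open>0 < t < 1\<close> and \<open>z > 0\<close>. Comparing
  two positive equilibria \<open>x, y\<close> at an index minimising \<open>x\<^sub>i / y\<^sub>i\<close> shows that this minimum is at
  least 1, and by symmetry \<open>x = y\<close>.

  For \<open>\<gamma> < 0\<close>, let \<open>v\<close> span the eigenspace. The linearisation at the bifurcation point is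
  injective on the complement of \<open>v\<close>, so two equilibria near it with the same \<open>u\<close> and the
  same component along \<open>v\<close> coincide. Since \<open>v \<circ> \<rho> = c v\<close> with \<open>c = 1\<close> or \<open>c = -1\<close>, this applies to
  \<open>x \<circ> \<rho>\<close> and \<open>c x\<close>.
\<close>

section \<open>Saturating functions\<close>

lemma saturating_odd: "saturating S \<Longrightarrow> S (- z) = - S z"
  by (simp add: saturating_def)

lemma saturating_has_derivative:
  assumes "saturating S"
  shows "(S has_real_derivative deriv S z) (at z)"
  using assms by (simp add: saturating_def DERIV_deriv_iff_field_differentiable)

lemma saturating_has_second_derivative:
  assumes "saturating S"
  shows "(deriv S has_real_derivative deriv (deriv S) z) (at z)"
  using assms by (simp add: saturating_def DERIV_deriv_iff_field_differentiable)

lemma saturating_deriv_less: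
  assumes S: "saturating S" and "0 \<le> a" "a < b"
  shows "deriv S b < deriv S a"
\<comment> \<open>The second derivative vanishes at 0, so the criterion that asks for its sign only
  in the open interval is what admits \<open>a = 0\<close>.\<close>
proof (rule DERIV_neg_imp_decreasing_open[OF \<open>a < b\<close>])
  fix z assume z: "a < z" "z < b"
  have "sgn (deriv (deriv S) z) = - sgn z"
    using S by (simp add: saturating_def)
  then have "deriv (deriv S) z < 0"
    using z \<open>0 \<le> a\<close> by (simp add: sgn_if split: if_splits)
  then show "\<exists>y. (deriv S has_real_derivative y) (at z) \<and> y < 0"
    using saturating_has_second_derivative[OF S] by blast
next
  show "continuous_on {a..b} (deriv S)"
    using saturating_has_second_derivative[OF S] by (meson DERIV_continuous_on DERIV_subset subset_UNIV)
qed

text \<open>Boundedness forces this. If \<open>S\<close> had a nonpositive slope at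
  \<open>z\<close>, the strict decrease of the slope would make it at most some \<open>m < 0\<close>
  from \<open>z + 1\<close> on, and \<open>S\<close> would fall below every bound.\<close>

lemma saturating_deriv_pos:
  assumes S: "saturating S" and "0 \<le> z"
  shows "0 < deriv S z"
proof (rule ccontr)
  assume "\<not> 0 < deriv S z"
  define b m where "b = z + 1" and "m = deriv S b"
  have m: "m < 0"
    using saturating_deriv_less[OF S \<open>0 \<le> z\<close>, of b] \<open>\<not> 0 < deriv S z\<close> by (simp add: b_def m_def)
  have le: "S c \<le> S b + (c - b) * m" if "b < c" for c
  proof -
    obtain \<xi> where \<xi>: "b < \<xi>" "\<xi> < c" "S c - S b = (c - b) * deriv S \<xi>"
      using MVT2[OF \<open>b < c\<close>, of S "deriv S"] saturating_has_derivative[OF S] by blast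
    have "deriv S \<xi> \<le> m"
      using saturating_deriv_less[OF S, of b \<xi>] \<xi> \<open>0 \<le> z\<close> by (simp add: b_def m_def)
    then have "(c - b) * deriv S \<xi> \<le> (c - b) * m"
      using that by (intro mult_left_mono) auto
    then show ?thesis using \<xi> by linarith
  qed
  obtain B where B: "\<And>c. \<bar>S c\<bar> \<le> B"
    using S by (auto simp: saturating_def bounded_iff)
  have "0 \<le> B" using B[of 0] by linarith
  \<comment> \<open>Chosen so that the line of slope \<open>m\<close> has dropped by
    \<open>2 * B + 1\<close> at \<open>c\<close>, more than two values of \<open>S\<close> can
    differ.\<close>
  define c where "c = b + (2 * B + 1) / (- m)"
  have "b < c" using m \<open>0 \<le> B\<close> by (simp add: c_def divide_pos_neg)
  moreover have "(c - b) * m = - (2 * B + 1)" using m by (simp add: c_def)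
  ultimately have "S c \<le> S b - (2 * B + 1)" using le by fastforce
  then show False using B[of b] B[of c] by linarith
qed

lemma saturating_mono:
  assumes S: "saturating S" and "0 \<le> a" "a \<le> b"
  shows "S a \<le> S b"
proof (rule DERIV_nonneg_imp_nondecreasing[OF \<open>a \<le> b\<close>])
  fix z assume "a \<le> z" "z \<le> b"
  then show "\<exists>y. (S has_real_derivative y) (at z) \<and> 0 \<le> y"
    using saturating_has_derivative[OF S] saturating_deriv_pos[OF S, of z] \<open>0 \<le> a\<close>
    by (meson less_imp_le order_trans)
qed

lemma saturating_pos_iff:
  assumes S: "saturating S"
  shows "0 < S z \<longleftrightarrow> 0 < z"
proof -
  have pos: "0 < S z" if "0 < z" for z
  proof -
    obtain \<xi> where \<xi>: "0 < \<xi>" "\<xi> < z" "S z - S 0 = (z - 0) * deriv S \<xi>"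
      using MVT2[OF \<open>0 < z\<close>, of S "deriv S"] saturating_has_derivative[OF S] by blast
    then show ?thesis
      using saturating_deriv_pos[OF S, of \<xi>] S that by (simp add: saturating_def)
  qed
  show ?thesis
    using pos[of z] pos[of "- z"] saturating_odd[OF S, of z] S
    by (cases z "0::real" rule: linorder_cases) (auto simp: saturating_def)
qed

text \<open>Strict concavity on the positive half-line together with \<open>S 0 = 0\<close>: the
  chord of \<open>S\<close> over \<open>[0, t z]\<close> is steeper than the one over
  \<open>[t z, z]\<close>.\<close>

lemma saturating_subhomogeneous:
  assumes S: "saturating S" and "0 < t" "t < 1" "0 < z"
  shows "t * S z < S (t * z)"
proof -
  have tz: "0 < t * z" "t * z < z" using assms by auto
  obtain \<xi> where \<xi>: "0 < \<xi>" "\<xi> < t * z" "S (t * z) - S 0 = (t * z - 0) * deriv S \<xi>"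
    using MVT2[OF tz(1), of S "deriv S"] saturating_has_derivative[OF S] by blast
  obtain \<zeta> where \<zeta>: "t * z < \<zeta>" "\<zeta> < z" "S z - S (t * z) = (z - t * z) * deriv S \<zeta>"
    using MVT2[OF tz(2), of S "deriv S"] saturating_has_derivative[OF S] by blast
  have "S 0 = 0" using S by (simp add: saturating_def)
  \<comment> \<open>The weights \<open>1 - t\<close> and \<open>t\<close> make both increments
    multiples of the same length \<open>(1 - t) * (t * z)\<close>, so only the two slopes remain to
    be compared.\<close>
  have "S (t * z) - t * S z = (1 - t) * (S (t * z) - S 0) - t * (S z - S (t * z))"
    using \<open>S 0 = 0\<close> by (simp add: algebra_simps)
  also have "\<dots> = (1 - t) * (t * z) * (deriv S \<xi> - deriv S \<zeta>)"
    unfolding \<xi>(3) \<zeta>(3) by (simp add: algebra_simps)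
  also have "\<dots> > 0"
    using saturating_deriv_less[OF S, of \<xi> \<zeta>] \<xi> \<zeta> assms by simp
  finally show ?thesis by simp
qed

text \<open>Since the slope is continuous and equals 1 at 0, \<open>S\<close> minus the identity has
  an arbitrarily small Lipschitz constant near 0. This replaces \<open>S\<close> by its
  linearisation in differences of equilibria.\<close>

lemma saturating_near_identity:
  assumes S: "saturating S" and "0 < \<eta>"
  obtains \<delta> where "0 < \<delta>"
    "\<And>a b. \<lbrakk>\<bar>a\<bar> < \<delta>; \<bar>b\<bar> < \<delta>\<rbrakk> \<Longrightarrow> \<bar>(S a - S b) - (a - b)\<bar> \<le> \<eta> * \<bar>a - b\<bar>"
proof -
  have "isCont (deriv S) 0"
    using saturating_has_second_derivative[OF S] by (rule DERIV_isCont)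
  moreover have "deriv S 0 = 1" using S by (simp add: saturating_def)
  ultimately obtain \<delta> where \<delta>: "0 < \<delta>" "\<And>z. \<bar>z\<bar> < \<delta> \<Longrightarrow> \<bar>deriv S z - 1\<bar> < \<eta>"
    using \<open>0 < \<eta>\<close> by (fastforce simp: continuous_at_eps_delta dist_real_def)
  show thesis
  proof
    fix a b :: real assume ab: "\<bar>a\<bar> < \<delta>" "\<bar>b\<bar> < \<delta>"
    have "norm ((S a - a) - (S b - b)) \<le> \<eta> * norm (a - b)"
    proof (rule field_differentiable_bound[where S = "ball 0 \<delta>" and f' = "\<lambda>z. deriv S z - 1"])
      fix z :: real assume "z \<in> ball 0 \<delta>"
      show "((\<lambda>z. S z - z) has_real_derivative deriv S z - 1) (at z within ball 0 \<delta>)"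
        by (intro DERIV_diff DERIV_ident DERIV_subset[OF saturating_has_derivative[OF S]]) auto
      show "norm (deriv S z - 1) \<le> \<eta>"
        using \<delta>(2)[of z] \<open>z \<in> ball 0 \<delta>\<close> by simp
    qed (use ab in auto)
    then show "\<bar>(S a - S b) - (a - b)\<bar> \<le> \<eta> * \<bar>a - b\<bar>"
      by (simp add: algebra_simps)
  qed fact
qed

section \<open>Symmetries of the equilibrium equation\<close>

text \<open>Without self-loops the diagonal of the adjacency matrix is zero, so the sum over the
  other vertices is a full matrix product.\<close>

lemma equilibrium_adjacency_iff:
  assumes "simple_graph E"
  shows "equilibrium d \<alpha> \<gamma> S (adjacency E) u x \<longleftrightarrow>
    (\<forall>i. d * x $ i = u * S (\<alpha> * x $ i + \<gamma> * (adjacency E *v x) $ i))"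
proof -
  have "(\<Sum>k\<in>UNIV - {i}. adjacency E $ i $ k * x $ k) = (adjacency E *v x) $ i" for i
    using assms by (simp add: matrix_vector_mult_def sum_diff1 adjacency_def simple_graph_def)
  then show ?thesis
    by (auto simp: equilibrium_def opinion_field_def vec_eq_iff)
qed

lemma equilibrium_uminus:
  assumes "saturating S" "simple_graph E"
    and "equilibrium d \<alpha> \<gamma> S (adjacency E) u x"
  shows "equilibrium d \<alpha> \<gamma> S (adjacency E) u (- x)"
  using assms(3) saturating_odd[OF assms(1), of "\<alpha> * x $ i + \<gamma> * (adjacency E *v x) $ i" for i]
  by (simp add: equilibrium_adjacency_iff[OF assms(2)] matrix_vector_mult_def sum_negf algebra_simps)

lemma adjacency_permute:
  assumes "\<rho> \<in> automorphisms E"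
  shows "adjacency E *v (\<chi> i. x $ \<rho> i) = (\<chi> i. (adjacency E *v x) $ \<rho> i)"
proof -
  have \<rho>: "bij \<rho>" "\<And>i k. E (\<rho> i) (\<rho> k) \<longleftrightarrow> E i k"
    using assms by (auto simp: automorphisms_def)
  have "(\<Sum>k\<in>UNIV. adjacency E $ i $ k * x $ \<rho> k) = (\<Sum>k\<in>UNIV. adjacency E $ \<rho> i $ k * x $ k)" for i
    using sum.reindex_bij_betw[OF \<rho>(1), of "\<lambda>k. adjacency E $ \<rho> i $ k * x $ k"]
    by (simp add: adjacency_def \<rho>(2))
  then show ?thesis
    by (simp add: matrix_vector_mult_def vec_eq_iff)
qed

lemma inner_permute:
  fixes x y :: "real^'n"
  assumes "bij \<rho>"
  shows "(\<chi> i. x $ \<rho> i) \<bullet> (\<chi> i. y $ \<rho> i) = x \<bullet> y"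
  using sum.reindex_bij_betw[OF assms, of "\<lambda>k. x $ k * y $ k"] by (simp add: inner_vec_def)

lemma norm_permute:
  fixes x :: "real^'n"
  assumes "bij \<rho>"
  shows "norm (\<chi> i. x $ \<rho> i) = norm x"
  by (simp add: norm_eq_sqrt_inner inner_permute[OF assms])

lemma equilibrium_permute:
  assumes "simple_graph E" "\<rho> \<in> automorphisms E"
    and "equilibrium d \<alpha> \<gamma> S (adjacency E) u x"
  shows "equilibrium d \<alpha> \<gamma> S (adjacency E) u (\<chi> i. x $ \<rho> i)"
  using assms(3) by (simp add: equilibrium_adjacency_iff[OF assms(1)] adjacency_permute[OF assms(2)])

section \<open>Uniqueness of positive equilibria\<close>

lemma positive_equilibrium_le:
  fixes E :: "'n::finite \<Rightarrow> 'n \<Rightarrow> bool"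
  assumes S: "saturating S" and E: "simple_graph E"
    and "0 < d" "0 \<le> \<alpha>" "0 \<le> \<gamma>" "0 \<le> u"
    and eqx: "equilibrium d \<alpha> \<gamma> S (adjacency E) u x"
    and eqy: "equilibrium d \<alpha> \<gamma> S (adjacency E) u y"
    and posx: "\<And>i. 0 < x $ i" and posy: "\<And>i. 0 < y $ i"
  shows "y $ k \<le> x $ k"
proof -
  define M where "M z i = \<alpha> * z $ i + \<gamma> * (adjacency E *v z) $ i" for z :: "real^'n" and i
  have x: "d * x $ i = u * S (M x i)" and y: "d * y $ i = u * S (M y i)" for i
    using eqx eqy by (auto simp: equilibrium_adjacency_iff[OF E] M_def)
  \<comment> \<open>The largest factor with \<open>t * y\<close> below \<open>x\<close> in every
    component; equality holds at the minimising index \<open>i\<close>.\<close>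
  define t where "t = Min (range (\<lambda>i. x $ i / y $ i))"
  have "t \<in> range (\<lambda>i. x $ i / y $ i)" unfolding t_def by (rule Min_in) auto
  then obtain i where i: "t = x $ i / y $ i" by blast
  have "0 < t" using posx posy i by simp
  have t: "t * y $ j \<le> x $ j" for j
  proof -
    have "t \<le> x $ j / y $ j" unfolding t_def by (rule Min_le) auto
    then show ?thesis using posy[of j] by (simp add: field_simps)
  qed
  have "1 \<le> t"
  proof (rule ccontr)
    assume "\<not> 1 \<le> t"
    \<comment> \<open>The equilibrium equation itself yields \<open>u > 0\<close> and a positive
      argument of \<open>S\<close>, as strict subhomogeneity requires.\<close>
    have uS: "0 < u * S (M y i)"
      using y[of i] posy[of i] \<open>0 < d\<close> by (metis mult_pos_pos)
    then have "0 < u" and "0 < S (M y i)"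
      using \<open>0 \<le> u\<close> by (auto simp: zero_less_mult_iff)
    then have "0 < M y i" using saturating_pos_iff[OF S] by blast
    have "(\<Sum>j\<in>UNIV. adjacency E $ i $ j * (t * y $ j)) \<le> (\<Sum>j\<in>UNIV. adjacency E $ i $ j * x $ j)"
      by (intro sum_mono mult_left_mono t) (auto simp: adjacency_def)
    then have "t * (adjacency E *v y) $ i \<le> (adjacency E *v x) $ i"
      by (simp add: matrix_vector_mult_def sum_distrib_left mult_ac)
    then have "\<alpha> * (t * y $ i) + \<gamma> * (t * (adjacency E *v y) $ i) \<le> M x i"
      unfolding M_def using \<open>0 \<le> \<alpha>\<close> \<open>0 \<le> \<gamma>\<close> t by (intro add_mono mult_left_mono) auto
    then have "t * M y i \<le> M x i" by (simp add: M_def algebra_simps)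
    then have "S (t * M y i) \<le> S (M x i)"
      using saturating_mono[OF S] \<open>0 < t\<close> \<open>0 < M y i\<close> by simp
    moreover have "t * S (M y i) < S (t * M y i)"
      using saturating_subhomogeneous[OF S \<open>0 < t\<close> _ \<open>0 < M y i\<close>] \<open>\<not> 1 \<le> t\<close> by simp
    ultimately have "u * (t * S (M y i)) < u * S (M x i)"
      using \<open>0 < u\<close> by (intro mult_strict_left_mono) auto
    then have "d * (t * y $ i) < d * x $ i"
      unfolding mult.left_commute[of _ t] x y .
    then show False using i posy[of i] \<open>0 < d\<close> by simp
  qed
  then have "y $ k \<le> t * y $ k" using posy[of k] by simp
  then show ?thesis using t[of k] by linarith
qed

lemma positive_equilibrium_unique:
  assumes "saturating S" "simple_graph E" "0 < d" "0 \<le> \<alpha>" "0 \<le> \<gamma>" "0 \<le> u"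
    and "equilibrium d \<alpha> \<gamma> S (adjacency E) u x" "equilibrium d \<alpha> \<gamma> S (adjacency E) u y"
    and "\<And>i. 0 < x $ i" "\<And>i. 0 < y $ i"
  shows "x = y"
  using positive_equilibrium_le[of S E d \<alpha> \<gamma> u x y] positive_equilibrium_le[of S E d \<alpha> \<gamma> u y x] assms
  by (simp add: vec_eq_iff order_antisym)

text \<open>An agreement vector has all entries positive or all negative. Oddness of
  \<open>S\<close> reduces the negative case to the positive one, where uniqueness makes the vector
  invariant under each automorphism.\<close>

lemma agreement_equilibrium_orbit:
  assumes S: "saturating S" and E: "simple_graph E"
    and "0 < d" "0 \<le> \<alpha>" "0 \<le> \<gamma>" "0 \<le> u"
    and eq: "equilibrium d \<alpha> \<gamma> S (adjacency E) u x"
    and "agreement x" "same_orbit E i k"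
  shows "x $ i = x $ k"
proof -
  obtain \<rho> where \<rho>: "\<rho> \<in> automorphisms E" "k = \<rho> i"
    using \<open>same_orbit E i k\<close> by (auto simp: same_orbit_def)
  have pos: "z $ i = z $ k"
    if "equilibrium d \<alpha> \<gamma> S (adjacency E) u z" "\<And>j. 0 < z $ j" for z
  proof -
    have "z = (\<chi> j. z $ \<rho> j)"
      using that assms(1-6) equilibrium_permute[OF E \<rho>(1) that(1)]
      by (intro positive_equilibrium_unique[of S E d \<alpha> \<gamma> u]) auto
    then have "z $ i = (\<chi> j. z $ \<rho> j) $ i" by simp
    then show ?thesis using \<rho>(2) by simp
  qed
  have sg: "x $ j \<noteq> 0" "sgn (x $ j) = sgn (x $ i)" for j
    using \<open>agreement x\<close> by (auto simp: agreement_def)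
  show ?thesis
  proof (cases "0 < x $ i")
    case True
    then have "0 < x $ j" for j using sg(2)[of j] by (simp add: sgn_if split: if_splits)
    then show ?thesis using pos[OF eq] by blast
  next
    case False
    then have "0 < (- x) $ j" for j
      using sg(1)[of i] sg(1)[of j] sg(2)[of j] by (simp add: sgn_if split: if_splits)
    then show ?thesis using pos[OF equilibrium_uminus[OF S E eq]] by simp
  qed
qed

section \<open>Local uniqueness near a simple bifurcation point\<close>

text \<open>The uniqueness half of a Lyapunov-Schmidt reduction: the component along
  \<open>v\<close> and the parameter \<open>u\<close> determine a small equilibrium. The
  linearisation is bounded below on the hyperplane orthogonal to \<open>v\<close>, and the nonlinear
  remainder and the shift of \<open>u\<close> are too small to compensate.\<close>

lemma equilibrium_locally_unique:
  fixes E :: "'n::finite \<Rightarrow> 'n \<Rightarrow> bool" and v :: "real^'n"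
  assumes S: "saturating S" and E: "simple_graph E"
    and inj: "\<And>z. \<lbrakk>v \<bullet> z = 0; d *\<^sub>R z = u0 *\<^sub>R (\<alpha> *\<^sub>R z + \<gamma> *\<^sub>R (adjacency E *v z))\<rbrakk> \<Longrightarrow> z = 0"
  obtains \<epsilon> where "0 < \<epsilon>"
    "\<And>x y u. \<lbrakk>norm x < \<epsilon>; norm y < \<epsilon>; \<bar>u - u0\<bar> < \<epsilon>; v \<bullet> x = v \<bullet> y;
      equilibrium d \<alpha> \<gamma> S (adjacency E) u x; equilibrium d \<alpha> \<gamma> S (adjacency E) u y\<rbrakk> \<Longrightarrow> x = y"
proof -
  define M where "M z = \<alpha> *\<^sub>R z + \<gamma> *\<^sub>R (adjacency E *v z)" for z :: "real^'n"
  have M: "bounded_linear M"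
    unfolding M_def by (intro bounded_linear_add bounded_linear_const_scaleR bounded_linear_ident
      matrix_vector_mul_bounded_linear)
  obtain K where K: "0 < K" "\<And>z. norm (M z) \<le> norm z * K"
    using bounded_linear.pos_bounded[OF M] by blast
  \<comment> \<open>In finite dimension, injectivity on a closed subspace gives a uniform lower
    bound.\<close>
  have "\<exists>e>0. \<forall>z\<in>{z. v \<bullet> z = 0}. e * norm z \<le> norm (d *\<^sub>R z - u0 *\<^sub>R M z)"
    by (rule injective_imp_isometric)
      (use inj in \<open>auto simp: closed_hyperplane subspace_hyperplane M_def
        intro!: bounded_linear_sub bounded_linear_const_scaleR bounded_linear_ident M[unfolded M_def]\<close>)
  then obtain e where e: "0 < e" "\<And>z. v \<bullet> z = 0 \<Longrightarrow> e * norm z \<le> norm (d *\<^sub>R z - u0 *\<^sub>R M z)"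
    by blast
  \<comment> \<open>The error has two sources, each allowed \<open>e / (4 * K)\<close>: the
    nonlinearity, through \<open>\<bar>u\<bar> * \<eta>\<close>, and the shift
    \<open>\<bar>u - u0\<bar>\<close>. Together they cost at most half of
    \<open>e * norm z\<close>.\<close>
  define \<eta> where "\<eta> = e / (4 * K * (\<bar>u0\<bar> + 1))"
  have "0 < \<eta>" using e K by (simp add: \<eta>_def)
  then obtain \<delta> where \<delta>: "0 < \<delta>"
    "\<And>a b. \<lbrakk>\<bar>a\<bar> < \<delta>; \<bar>b\<bar> < \<delta>\<rbrakk> \<Longrightarrow> \<bar>(S a - S b) - (a - b)\<bar> \<le> \<eta> * \<bar>a - b\<bar>"
    using saturating_near_identity[OF S] by metis
  \<comment> \<open>The three bounds respectively keep \<open>\<bar>u\<bar>\<close> below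
    \<open>\<bar>u0\<bar> + 1\<close>, limit the shift of \<open>u\<close>, and keep the arguments
    of \<open>S\<close> within \<delta> of 0.\<close>
  define \<epsilon> where "\<epsilon> = min 1 (min (e / (4 * K)) (\<delta> / K))"
  have "0 < \<epsilon>" using e K \<delta> by (simp add: \<epsilon>_def)
  moreover have "x = y"
    if small: "norm x < \<epsilon>" "norm y < \<epsilon>" "\<bar>u - u0\<bar> < \<epsilon>" and v: "v \<bullet> x = v \<bullet> y"
      and eqx: "equilibrium d \<alpha> \<gamma> S (adjacency E) u x"
      and eqy: "equilibrium d \<alpha> \<gamma> S (adjacency E) u y" for x y u
  proof -
    have M_small: "\<bar>M w $ i\<bar> < \<delta>" if "norm w < \<epsilon>" for w i
    proof -
      have "\<bar>M w $ i\<bar> \<le> norm w * K"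
        using component_le_norm_cart[of "M w" i] K(2)[of w] by linarith
      also have "\<dots> < \<delta>" using that K(1) by (simp add: \<epsilon>_def field_simps)
      finally show ?thesis .
    qed
    define z where "z = x - y"
    have Mz: "M z = M x - M y" unfolding z_def by (rule linear_diff[OF bounded_linear.linear[OF M]])
    have comp: "norm ((d *\<^sub>R z - u0 *\<^sub>R M z) $ i) \<le> norm (((\<bar>u\<bar> * \<eta> + \<bar>u - u0\<bar>) *\<^sub>R M z) $ i)" for i
    proof -
      have "d * z $ i = u * (S (M x $ i) - S (M y $ i))"
        using eqx eqy by (simp add: equilibrium_adjacency_iff[OF E] z_def M_def right_diff_distrib)
      then have "(d *\<^sub>R z - u0 *\<^sub>R M z) $ i
          = u * ((S (M x $ i) - S (M y $ i)) - M z $ i) + (u - u0) * M z $ i"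
        by (simp add: algebra_simps)
      also have "\<bar>\<dots>\<bar> \<le> \<bar>u\<bar> * \<bar>(S (M x $ i) - S (M y $ i)) - M z $ i\<bar> + \<bar>u - u0\<bar> * \<bar>M z $ i\<bar>"
        by (metis abs_mult abs_triangle_ineq)
      also have "\<dots> \<le> \<bar>u\<bar> * (\<eta> * \<bar>M z $ i\<bar>) + \<bar>u - u0\<bar> * \<bar>M z $ i\<bar>"
        using \<delta>(2)[OF M_small[OF small(1)] M_small[OF small(2)], of i i]
        by (intro add_mono mult_left_mono) (auto simp: Mz)
      also have "\<dots> = \<bar>(\<bar>u\<bar> * \<eta> + \<bar>u - u0\<bar>) * M z $ i\<bar>"
        using \<open>0 < \<eta>\<close> unfolding abs_mult by (simp add: algebra_simps)
      finally show ?thesis by simp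
    qed
    have "\<bar>u\<bar> \<le> \<bar>u0\<bar> + 1" using small(3) unfolding \<epsilon>_def by linarith
    then have "\<bar>u\<bar> * \<eta> \<le> (\<bar>u0\<bar> + 1) * \<eta>" using \<open>0 < \<eta>\<close> by simp
    also have "\<dots> = e / (4 * K)"
      using K(1) by (simp add: \<eta>_def divide_simps)
    finally have c: "\<bar>u\<bar> * \<eta> + \<bar>u - u0\<bar> \<le> e / (2 * K)"
      using small(3) by (simp add: \<epsilon>_def)
    have "e * norm z \<le> norm (d *\<^sub>R z - u0 *\<^sub>R M z)"
      using v by (intro e) (simp add: z_def inner_diff_right)
    also have "\<dots> \<le> norm ((\<bar>u\<bar> * \<eta> + \<bar>u - u0\<bar>) *\<^sub>R M z)"
      using comp by (rule norm_le_componentwise_cart)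
    also have "\<dots> = (\<bar>u\<bar> * \<eta> + \<bar>u - u0\<bar>) * norm (M z)"
      using \<open>0 < \<eta>\<close> by simp
    also have "\<dots> \<le> e / (2 * K) * (norm z * K)"
      using c K e by (intro mult_mono) auto
    also have "\<dots> = e * norm z / 2" using K(1) by simp
    finally have "norm z = 0" using e(1) by simp
    then show ?thesis by (simp add: z_def)
  qed
  ultimately show thesis using that by blast
qed

section \<open>Simple eigenvalues: automorphisms act on nearby equilibria by a sign\<close>

lemma eigenspace_simple:
  assumes "eigen_multiplicity A l = 1"
  obtains v where "v \<noteq> 0" "A *v v = l *\<^sub>R v" "\<And>w. A *v w = l *\<^sub>R w \<Longrightarrow> \<exists>c. w = c *\<^sub>R v"
proof -
  obtain B where B: "B \<subseteq> eigenspace A l" "independent B" "eigenspace A l \<subseteq> span B"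
    "card B = dim (eigenspace A l)"
    using basis_exists by blast
  then obtain v where v: "B = {v}"
    using assms by (metis card_1_singletonE eigen_multiplicity_def)
  show thesis
  proof
    show "v \<noteq> 0" using B(2) v dependent_zero by blast
    show "A *v v = l *\<^sub>R v" using B(1) v by (simp add: eigenspace_def)
    show "\<exists>c. w = c *\<^sub>R v" if "A *v w = l *\<^sub>R w" for w
      using B(3) that by (auto simp: v eigenspace_def span_singleton)
  qed
qed

lemma simple_bifurcation_orbit:
  fixes E :: "'n::finite \<Rightarrow> 'n \<Rightarrow> bool"
  assumes S: "saturating S" and E: "simple_graph E" and "d \<noteq> 0" "\<gamma> \<noteq> 0"
    and simple: "eigen_multiplicity (adjacency E) l = 1"
    and u0: "u0 = d / (\<alpha> + \<gamma> * l)"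
  obtains \<epsilon> where "0 < \<epsilon>"
    "\<And>x u i k. \<lbrakk>norm x < \<epsilon>; \<bar>u - u0\<bar> < \<epsilon>; equilibrium d \<alpha> \<gamma> S (adjacency E) u x;
      same_orbit E i k\<rbrakk> \<Longrightarrow> \<bar>x $ i\<bar> = \<bar>x $ k\<bar>"
proof -
  let ?A = "adjacency E"
  obtain v where v: "v \<noteq> 0" "?A *v v = l *\<^sub>R v" "\<And>w. ?A *v w = l *\<^sub>R w \<Longrightarrow> \<exists>c. w = c *\<^sub>R v"
    using eigenspace_simple[OF simple] by metis
  have inj: "z = 0"
    if "v \<bullet> z = 0" and z: "d *\<^sub>R z = u0 *\<^sub>R (\<alpha> *\<^sub>R z + \<gamma> *\<^sub>R (?A *v z))" for z
  proof (cases "\<alpha> + \<gamma> * l = 0")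
    case True
    \<comment> \<open>Division by zero makes \<open>u0 = 0\<close> here.\<close>
    then show ?thesis using z u0 \<open>d \<noteq> 0\<close> by simp
  next
    case False
    \<comment> \<open>Clearing the denominator of \<open>u0\<close> lets \<open>d\<close> and then
      the \<alpha> terms cancel; what remains is the eigenvector equation, so the kernel of the
      linearisation lies in the line of \<open>v\<close>.\<close>
    have "?A *v z = l *\<^sub>R z"
    proof (subst vec_eq_iff, intro allI)
      fix i
      have "d * z $ i = u0 * (\<alpha> * z $ i + \<gamma> * (?A *v z) $ i)"
        using arg_cong[OF z, of "\<lambda>w. w $ i"] by simp
      then have "d * z $ i * (\<alpha> + \<gamma> * l) = d * (\<alpha> * z $ i + \<gamma> * (?A *v z) $ i)"
        using False u0 by (simp add: eq_divide_eq)
      then have "z $ i * (\<alpha> + \<gamma> * l) = \<alpha> * z $ i + \<gamma> * (?A *v z) $ i"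
        using \<open>d \<noteq> 0\<close> by simp
      then have "\<gamma> * (?A *v z) $ i = \<gamma> * (l * z $ i)" by (auto simp: algebra_simps)
      then show "(?A *v z) $ i = (l *\<^sub>R z) $ i" using \<open>\<gamma> \<noteq> 0\<close> by simp
    qed
    then obtain c where "z = c *\<^sub>R v" using v(3) by blast
    then show ?thesis using \<open>v \<bullet> z = 0\<close> v(1) by simp
  qed
  obtain \<epsilon> where \<epsilon>: "0 < \<epsilon>"
    "\<And>x y u. \<lbrakk>norm x < \<epsilon>; norm y < \<epsilon>; \<bar>u - u0\<bar> < \<epsilon>; v \<bullet> x = v \<bullet> y;
      equilibrium d \<alpha> \<gamma> S ?A u x; equilibrium d \<alpha> \<gamma> S ?A u y\<rbrakk> \<Longrightarrow> x = y"
    using equilibrium_locally_unique[OF S E inj] by metis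
  have "\<bar>x $ i\<bar> = \<bar>x $ k\<bar>"
    if x: "norm x < \<epsilon>" "\<bar>u - u0\<bar> < \<epsilon>" "equilibrium d \<alpha> \<gamma> S ?A u x"
      and "same_orbit E i k" for x u i k
  proof -
    obtain \<rho> where \<rho>: "\<rho> \<in> automorphisms E" "k = \<rho> i"
      using \<open>same_orbit E i k\<close> by (auto simp: same_orbit_def)
    then have "bij \<rho>" by (simp add: automorphisms_def)
    define P where "P w = (\<chi> j. w $ \<rho> j)" for w :: "real^'n"
    have "?A *v P v = l *\<^sub>R P v"
      unfolding P_def by (simp add: adjacency_permute[OF \<rho>(1)] v(2) vec_eq_iff)
    then obtain c where c: "P v = c *\<^sub>R v" using v(3) by blast
    \<comment> \<open>\<open>P\<close> preserves the line of \<open>v\<close> and is an isometry, so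
      its factor there is a sign.\<close>
    have "norm (P v) = norm v" unfolding P_def by (rule norm_permute[OF \<open>bij \<rho>\<close>])
    then have "\<bar>c\<bar> = 1" using c v(1) by simp
    then have c1: "c * c = 1" "c = 1 \<or> c = -1" by (auto simp: abs_if split: if_splits)
    \<comment> \<open>The left side is the inner product of \<open>P v\<close> and
      \<open>P x\<close>. As \<open>c * c = 1\<close>, the vectors \<open>P x\<close> and
      \<open>c *\<^sub>R x\<close> then have the same component along \<open>v\<close>.\<close>
    have "c * (v \<bullet> P x) = v \<bullet> x"
      using inner_permute[OF \<open>bij \<rho>\<close>, of v x] c by (simp add: P_def)
    then have "v \<bullet> P x = v \<bullet> (c *\<^sub>R x)"
      using c1 by auto
    moreover have "equilibrium d \<alpha> \<gamma> S ?A u (c *\<^sub>R x)"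
      using c1(2) x(3) equilibrium_uminus[OF S E x(3)] by auto
    moreover have "equilibrium d \<alpha> \<gamma> S ?A u (P x)"
      unfolding P_def by (rule equilibrium_permute[OF E \<rho>(1) x(3)])
    moreover have "norm (P x) < \<epsilon>"
      using x(1) by (simp add: P_def norm_permute[OF \<open>bij \<rho>\<close>])
    moreover have "norm (c *\<^sub>R x) < \<epsilon>"
      using x(1) \<open>\<bar>c\<bar> = 1\<close> by simp
    ultimately have "P x = c *\<^sub>R x"
      using \<epsilon>(2) x(2) by blast
    then have "x $ k = c * x $ i"
      using \<rho>(2) by (simp add: P_def vec_eq_iff)
    then show ?thesis using \<open>\<bar>c\<bar> = 1\<close> by (simp add: abs_mult)
  qed
  then show thesis using that \<epsilon>(1) by blast
qed

theorem theorem6: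
  fixes E :: "'n::finite \<Rightarrow> 'n \<Rightarrow> bool"
    and S :: "real \<Rightarrow> real"
    and d \<alpha> \<gamma> :: real
  assumes "CARD('n) \<ge> 2"
    and "simple_graph E" and "connected_graph E"
    and "saturating S"
    and "d > 0" and "\<alpha> \<ge> 0"
  shows
    "(\<gamma> > 0 \<longrightarrow>
       (let A = adjacency E; l = lambda_max A; ua = d / (\<alpha> + \<gamma> * l) in
        \<exists>\<epsilon>>0. \<forall>p. emerging_branch d \<alpha> \<gamma> S A ua (eigenspace A l) p \<longrightarrow>
          (\<forall>s\<in>{0<..1}. \<forall>x u. p s = (x, u) \<and> dist (x, u) (0, ua) < \<epsilon> \<and> agreement x \<longrightarrow>
             (\<forall>i k. same_orbit E i k \<longrightarrow> x $ i = x $ k)))) \<and>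
     (\<gamma> < 0 \<and> eigen_multiplicity (adjacency E) (lambda_min (adjacency E)) = 1 \<longrightarrow>
       (let A = adjacency E; l = lambda_min A; ud = d / (\<alpha> + \<gamma> * l) in
        \<exists>\<epsilon>>0. \<forall>p. emerging_branch d \<alpha> \<gamma> S A ud (eigenspace A l) p \<longrightarrow>
          (\<forall>s\<in>{0<..1}. \<forall>x u. p s = (x, u) \<and> dist (x, u) (0, ud) < \<epsilon> \<and> disagreement x \<longrightarrow>
             (\<forall>i k. same_orbit E i k \<longrightarrow> \<bar>x $ i\<bar> = \<bar>x $ k\<bar>))))"
proof (intro conjI impI)
  assume "\<gamma> > 0"
  show "let A = adjacency E; l = lambda_max A; ua = d / (\<alpha> + \<gamma> * l) in
        \<exists>\<epsilon>>0. \<forall>p. emerging_branch d \<alpha> \<gamma> S A ua (eigenspace A l) p \<longrightarrow>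
          (\<forall>s\<in>{0<..1}. \<forall>x u. p s = (x, u) \<and> dist (x, u) (0, ua) < \<epsilon> \<and> agreement x \<longrightarrow>
             (\<forall>i k. same_orbit E i k \<longrightarrow> x $ i = x $ k))"
    unfolding Let_def
  \<comment> \<open>The radius 1 is arbitrary: uniqueness of positive equilibria is global.\<close>
  proof (intro exI[of _ 1] conjI allI ballI impI)
    fix p :: "real \<Rightarrow> (real^'n) \<times> real" and s x u i k
    assume p: "emerging_branch d \<alpha> \<gamma> S (adjacency E)
        (d / (\<alpha> + \<gamma> * lambda_max (adjacency E)))
        (eigenspace (adjacency E) (lambda_max (adjacency E))) p"
      and s: "s \<in> {0<..1}"
      and x: "p s = (x, u) \<and> dist (x, u) (0, d / (\<alpha> + \<gamma> * lambda_max (adjacency E))) < 1 \<and>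
        agreement x"
      and ik: "same_orbit E i k"
    from p s have "0 \<le> snd (p s) \<and> equilibrium d \<alpha> \<gamma> S (adjacency E) (snd (p s)) (fst (p s))"
      unfolding emerging_branch_def by blast
    then have "0 \<le> u" "equilibrium d \<alpha> \<gamma> S (adjacency E) u x"
      using x by auto
    then show "x $ i = x $ k"
      using agreement_equilibrium_orbit[of S E d \<alpha> \<gamma> u x i k] assms \<open>\<gamma> > 0\<close> x ik by simp
  qed simp
next
  assume B: "\<gamma> < 0 \<and> eigen_multiplicity (adjacency E) (lambda_min (adjacency E)) = 1"
  define ud where "ud = d / (\<alpha> + \<gamma> * lambda_min (adjacency E))"
  obtain \<epsilon> where \<epsilon>: "0 < \<epsilon>"
    "\<And>x u i k. \<lbrakk>norm x < \<epsilon>; \<bar>u - ud\<bar> < \<epsilon>; equilibrium d \<alpha> \<gamma> S (adjacency E) u x;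
      same_orbit E i k\<rbrakk> \<Longrightarrow> \<bar>x $ i\<bar> = \<bar>x $ k\<bar>"
    using simple_bifurcation_orbit[OF assms(4,2) _ _ _ ud_def] B \<open>d > 0\<close> by (metis less_irrefl)
  show "let A = adjacency E; l = lambda_min A; ud = d / (\<alpha> + \<gamma> * l) in
        \<exists>\<epsilon>>0. \<forall>p. emerging_branch d \<alpha> \<gamma> S A ud (eigenspace A l) p \<longrightarrow>
          (\<forall>s\<in>{0<..1}. \<forall>x u. p s = (x, u) \<and> dist (x, u) (0, ud) < \<epsilon> \<and> disagreement x \<longrightarrow>
             (\<forall>i k. same_orbit E i k \<longrightarrow> \<bar>x $ i\<bar> = \<bar>x $ k\<bar>))"
    unfolding Let_def ud_def[symmetric]
  proof (intro exI[of _ \<epsilon>] conjI allI ballI impI)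
    fix p :: "real \<Rightarrow> (real^'n) \<times> real" and s x u i k
    assume p: "emerging_branch d \<alpha> \<gamma> S (adjacency E) ud
        (eigenspace (adjacency E) (lambda_min (adjacency E))) p"
      and s: "s \<in> {0<..1}"
      and x: "p s = (x, u) \<and> dist (x, u) (0, ud) < \<epsilon> \<and> disagreement x"
      and ik: "same_orbit E i k"
    from p s have "equilibrium d \<alpha> \<gamma> S (adjacency E) (snd (p s)) (fst (p s))"
      unfolding emerging_branch_def by blast
    then have "equilibrium d \<alpha> \<gamma> S (adjacency E) u x"
      using x by simp
    \<comment> \<open>The distance in the product space dominates the distance in each
      factor.\<close>
    moreover have "norm x < \<epsilon>" "\<bar>u - ud\<bar> < \<epsilon>"
      using x dist_fst_le[of "(x, u)" "(0, ud)"] dist_snd_le[of "(x, u)" "(0, ud)"]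
      by (auto simp: dist_real_def)
    ultimately show "\<bar>x $ i\<bar> = \<bar>x $ k\<bar>" using \<epsilon>(2) ik by blast
  qed (rule \<epsilon>(1))
qed

end
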